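(* Let $d\ge1$, $V$ a finite set of boxes, $w: V\to\mathbb{Q}_{\ge0}^d$ a size function and $W\in\mathbb{Q}_{>0}^d$ a container size. Let $E=(E_1,\dots,E_d)$ be a packing class for $(V,w)$, let $i\in\{1,\dots,d\}$, $G_i=(V,E_i)$, and $S\subseteq V$. Then the induced subgraph $G_i[S]$ contains a clique of size $\left\lceil \frac{\sum_{s\in S} w_i(s)}{W_i}\right\rceil$.
   Context: A set $T\subseteq V$ is $x_i$-feasible if $\sum_{b\in T}w_i(b)\le W_i$. A packing class for $(V,w)$ (with respect to container $W$) is a tuple $E=(E_1,\dots,E_d)$ of edge sets of simple undirected graphs on vertex set $V$ such that P1: each $G_i=(V,E_i)$ is an interval graph; P2: every stable set of $G_i$ is $x_i$-feasible, for each $i$; P3: $\bigcap_{i=1}^d E_i=\emptyset$. $G_i[S]$ denotes the subgraph of $G_i$ induced by $S$. *)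

theory Defs
  imports "HOL-Analysis.Analysis" "HOL-Library.Ramsey"
begin

text \<open>
  A simple undirected graph is a pair of a vertex set \<open>V\<close> and an edge set \<open>F\<close> of two-element
  subsets of \<open>V\<close>, as in \<^theory>\<open>HOL-Library.Ramsey\<close>, whose predicates \<open>clique\<close> and \<open>indep\<close>
  (stable set) are used below. There, \<open>clique C F\<close> and \<open>indep C F\<close> take the vertex set \<open>C\<close>
  first, and do not by themselves require \<open>C\<close> to lie in the vertex set of the graph.
\<close>

definition simple_graph :: "'v set \<Rightarrow> 'v set set \<Rightarrow> bool" where
  "simple_graph V F \<longleftrightarrow> F \<subseteq> [V]\<^bsup>2\<^esup>"

definition induced_edges :: "'v set set \<Rightarrow> 'v set \<Rightarrow> 'v set set" where
  "induced_edges F S = {e \<in> F. e \<subseteq> S}"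

text \<open>
  Intervals of the real line may be open, closed, half-open or unbounded; for finite graphs
  this yields the same class as closed bounded intervals.
\<close>

definition interval_graph :: "'v set \<Rightarrow> 'v set set \<Rightarrow> bool" where
  "interval_graph V F \<longleftrightarrow> simple_graph V F \<and>
     (\<exists>I :: 'v \<Rightarrow> real set.
        (\<forall>v\<in>V. is_interval (I v) \<and> I v \<noteq> {}) \<and>
        (\<forall>u\<in>V. \<forall>v\<in>V. u \<noteq> v \<longrightarrow> ({u, v} \<in> F \<longleftrightarrow> I u \<inter> I v \<noteq> {})))"

text \<open>
  Coordinates are indexed by \<open>{1..d}\<close>: \<open>w i b\<close> is the size of box \<open>b\<close> in direction \<open>i\<close>, and
  \<open>W i\<close> is the size of the container in direction \<open>i\<close>.
\<close>

definition feasible ::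
  "'v set \<Rightarrow> (nat \<Rightarrow> 'v \<Rightarrow> rat) \<Rightarrow> (nat \<Rightarrow> rat) \<Rightarrow> nat \<Rightarrow> 'v set \<Rightarrow> bool" where
  "feasible V w W i T \<longleftrightarrow> T \<subseteq> V \<and> (\<Sum>b\<in>T. w i b) \<le> W i"

definition packing_class ::
  "nat \<Rightarrow> 'v set \<Rightarrow> (nat \<Rightarrow> 'v \<Rightarrow> rat) \<Rightarrow> (nat \<Rightarrow> rat) \<Rightarrow> (nat \<Rightarrow> 'v set set) \<Rightarrow> bool" where
  "packing_class d V w W E \<longleftrightarrow>
     (\<forall>i\<in>{1..d}. simple_graph V (E i)) \<and>
     (\<forall>i\<in>{1..d}. interval_graph V (E i)) \<and>
     (\<forall>i\<in>{1..d}. \<forall>T. T \<subseteq> V \<and> indep T (E i) \<longrightarrow> feasible V w W i T) \<and>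
     (\<Inter>i\<in>{1..d}. E i) = {}"

end

theory Submission
  imports Defs
begin

text \<open>
  Removing repeatedly the interval that ends first colours a finite family of intervals greedily:
  all intervals meeting it share its right end, so if every point lies in at most \<open>k\<close> intervals,
  then \<open>k\<close> colours suffice. If every clique of \<open>G\<^sub>i[S]\<close> had fewer than \<open>m = \<lceil>w\<^sub>i(S) / W\<^sub>i\<rceil>\<close> vertices,
  then \<open>S\<close> would split into \<open>m - 1\<close> stable sets, each of weight at most \<open>W\<^sub>i\<close>, and \<open>w\<^sub>i(S)\<close> would be
  at most \<open>(m - 1) W\<^sub>i\<close>.
\<close>

text \<open>
  The intervals need not be closed or bounded, so the right end of \<open>I v\<close> is replaced by the
  largest of finitely many chosen points \<open>p u v\<close> in the intersections \<open>I u \<inter> I v\<close>.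
\<close>

lemma ex_interval_ending_first:
  fixes I :: "'a \<Rightarrow> real set"
  assumes "finite S" "S \<noteq> {}"
    and ivl: "\<And>v. v \<in> S \<Longrightarrow> is_interval (I v) \<and> I v \<noteq> {}"
  obtains v x where "v \<in> S" "\<And>u. u \<in> S \<Longrightarrow> I u \<inter> I v \<noteq> {} \<Longrightarrow> x \<in> I u"
proof -
  define p where "p u v = (SOME x. x \<in> I u \<inter> I v)" for u v
  have p: "p u v \<in> I u \<inter> I v" if "I u \<inter> I v \<noteq> {}" for u v
    using that unfolding p_def some_in_eq .
  define P where "P v = (\<lambda>u. p u v) ` {u \<in> S. I u \<inter> I v \<noteq> {}}" for v
  have fin: "finite (P v)" for v
    using \<open>finite S\<close> by (simp add: P_def)
  \<comment> \<open>A nonempty interval meets itself, so \<open>p v v\<close> is always among the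
    chosen points.\<close>
  have nonempty: "P v \<noteq> {}" if "v \<in> S" for v
    using that ivl[OF that] unfolding P_def by blast
  define r where "r v = Max (P v)" for v
  have r_mem: "r v \<in> I v" if "v \<in> S" for v
    using Max_in[OF fin nonempty[OF that]] p unfolding r_def P_def by fastforce
  obtain v where v: "v \<in> S" "\<And>u. u \<in> S \<Longrightarrow> r v \<le> r u"
    using ex_is_arg_min_if_finite[OF assms(1,2), of r] unfolding is_arg_min_linorder by blast
  \<comment> \<open>Here \<open>p u v \<le> r v \<le> r u\<close>, by maximality of
    \<open>r v\<close> in \<open>P v\<close> and the choice of \<open>v\<close>. Both outer points
    lie in \<open>I u\<close>, so convexity puts \<open>r v\<close> there too.\<close>
  have "r v \<in> I u" if u: "u \<in> S" and meet: "I u \<inter> I v \<noteq> {}" for u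
  proof -
    have "p u v \<in> P v"
      using u meet unfolding P_def by blast
    then have "p u v \<le> r v"
      using fin by (simp add: r_def)
    with v(2)[OF u] show ?thesis
      using ivl[OF u] p[OF meet] r_mem[OF u] by (blast intro: mem_is_interval_1_I)
  qed
  with v(1) show thesis
    using that by blast
qed

text \<open>Bounding the intervals through a point, rather than clique sizes, avoids Helly's
  theorem: the preceding lemma supplies the common point directly.\<close>

lemma interval_colouring:
  fixes I :: "'a \<Rightarrow> real set"
  assumes "finite S"
    and "\<And>v. v \<in> S \<Longrightarrow> is_interval (I v) \<and> I v \<noteq> {}"
    and "\<And>x. card {v \<in> S. x \<in> I v} \<le> k"
  shows "\<exists>c. c ` S \<subseteq> {..<k} \<and> (\<forall>u\<in>S. \<forall>v\<in>S. u \<noteq> v \<and> c u = c v \<longrightarrow> I u \<inter> I v = {})"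
  using assms
proof (induction S rule: finite_psubset_induct)
  case (psubset S)
  show ?case
  proof (cases "S = {}")
    case False
    obtain v x where v: "v \<in> S" and x: "\<And>u. u \<in> S \<Longrightarrow> I u \<inter> I v \<noteq> {} \<Longrightarrow> x \<in> I u"
      using ex_interval_ending_first[OF psubset.hyps False, of I] psubset.prems(1) by metis
    let ?T = "S - {v}"
    have "card {u \<in> ?T. y \<in> I u} \<le> k" for y
      using psubset.hyps by (intro order_trans[OF card_mono psubset.prems(2)[of y]]) auto
    moreover have "?T \<subset> S" "\<And>u. u \<in> ?T \<Longrightarrow> is_interval (I u) \<and> I u \<noteq> {}"
      using v psubset.prems(1) by auto
    ultimately have "\<exists>c. c ` ?T \<subseteq> {..<k} \<and>
        (\<forall>u\<in>?T. \<forall>w\<in>?T. u \<noteq> w \<and> c u = c w \<longrightarrow> I u \<inter> I w = {})"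
      by (intro psubset.IH)
    then obtain c where
      c: "c ` ?T \<subseteq> {..<k}" "\<And>u w. \<lbrakk>u \<in> ?T; w \<in> ?T; u \<noteq> w; c u = c w\<rbrakk> \<Longrightarrow> I u \<inter> I w = {}"
      by auto
    \<comment> \<open>\<open>N\<close> holds the intervals whose colours are forbidden for
      \<open>v\<close>. They all contain \<open>x\<close>, and so does \<open>I v\<close>; counting
      \<open>v\<close> among the at most \<open>k\<close> intervals through \<open>x\<close> leaves
      a colour free.\<close>
    define N where "N = {u \<in> ?T. I u \<inter> I v \<noteq> {}}"
    have "x \<in> I v"
      using x[OF v] psubset.prems(1)[OF v] by simp
    with x v have "insert v N \<subseteq> {u \<in> S. x \<in> I u}"
      by (auto simp: N_def)
    then have "card (insert v N) \<le> k"
      using psubset.hyps by (intro order_trans[OF card_mono psubset.prems(2)[of x]]) auto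
    moreover have "finite N" "v \<notin> N"
      using psubset.hyps by (auto simp: N_def)
    ultimately have "card N < k"
      by simp
    then have "card (c ` N) < card {..<k}"
      using card_image_le[OF \<open>finite N\<close>, of c] by simp
    then have "\<not> {..<k} \<subseteq> c ` N"
      using card_mono[of "c ` N" "{..<k}"] \<open>finite N\<close> by auto
    then obtain a where a: "a < k" "a \<notin> c ` N"
      by auto
    have disj: "I u \<inter> I v = {}" if "u \<in> ?T" "c u = a" for u
      using that a(2) by (auto simp: N_def)
    have "(c(v := a)) ` S \<subseteq> {..<k}"
      using c(1) a(1) by auto
    moreover have "I u \<inter> I w = {}"
      if "u \<in> S" "w \<in> S" "u \<noteq> w" "(c(v := a)) u = (c(v := a)) w" for u w
      using that c(2)[of u w] disj[of u] disj[of w] by (auto split: if_splits)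
    ultimately show ?thesis
      by blast
  qed auto
qed

theorem theorem2:
  fixes d :: nat
    and V :: "'v set"
    and w :: "nat \<Rightarrow> 'v \<Rightarrow> rat"
    and W :: "nat \<Rightarrow> rat"
    and E :: "nat \<Rightarrow> 'v set set"
    and i :: nat
    and S :: "'v set"
  assumes "d \<ge> 1"
    and "finite V"
    and "\<And>j b. j \<in> {1..d} \<Longrightarrow> b \<in> V \<Longrightarrow> w j b \<ge> 0"
    and "\<And>j. j \<in> {1..d} \<Longrightarrow> W j > 0"
    and "packing_class d V w W E"
    and "i \<in> {1..d}"
    and "S \<subseteq> V"
  shows "\<exists>C. C \<subseteq> S \<and> clique C (induced_edges (E i) S) \<and>
           int (card C) = \<lceil>(\<Sum>s\<in>S. w i s) / W i\<rceil>"
\<comment> \<open>A ceiling of 0 is witnessed by the empty clique. Otherwise \<open>m > 0\<close>,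
  so the truncated subtraction \<open>m - 1\<close> below is a true one.\<close>
proof (cases "\<lceil>(\<Sum>s\<in>S. w i s) / W i\<rceil> \<le> 0")
  case True
  have "0 \<le> (\<Sum>s\<in>S. w i s) / W i"
    using assms(3)[OF assms(6)] assms(4)[OF assms(6)] assms(7)
    by (intro divide_nonneg_pos sum_nonneg) auto
  then have "0 \<le> \<lceil>(\<Sum>s\<in>S. w i s) / W i\<rceil>"
    by linarith
  with True have "int (card {}) = \<lceil>(\<Sum>s\<in>S. w i s) / W i\<rceil>"
    by (simp only: card.empty of_nat_0)
  then show ?thesis
    by (intro exI[of _ "{}"]) (simp add: clique_def)
next
  case False
  define m where "m = nat \<lceil>(\<Sum>s\<in>S. w i s) / W i\<rceil>"
  have m: "m > 0" "int m = \<lceil>(\<Sum>s\<in>S. w i s) / W i\<rceil>"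
    using False by (simp_all add: m_def)
  have Wpos: "W i > 0"
    using assms(4,6) by blast
  have "finite S"
    using assms(2,7) by (rule rev_finite_subset)
  have "interval_graph V (E i)"
    and stable: "\<And>T. T \<subseteq> V \<Longrightarrow> indep T (E i) \<Longrightarrow> (\<Sum>b\<in>T. w i b) \<le> W i"
    using assms(5,6) by (auto simp: packing_class_def feasible_def)
  then obtain I :: "'v \<Rightarrow> real set" where
    ivl: "\<And>v. v \<in> V \<Longrightarrow> is_interval (I v) \<and> I v \<noteq> {}" and
    edge: "\<And>u v. u \<in> V \<Longrightarrow> v \<in> V \<Longrightarrow> u \<noteq> v \<Longrightarrow> {u, v} \<in> E i \<longleftrightarrow> I u \<inter> I v \<noteq> {}"
    unfolding interval_graph_def by metis
  \<comment> \<open>The clique will consist of vertices whose intervals share one point.\<close>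
  have "\<exists>x. m \<le> card {v \<in> S. x \<in> I v}"
  proof (rule ccontr)
    assume "\<not> ?thesis"
    then have "card {v \<in> S. x \<in> I v} \<le> m - 1" for x
      using m(1) by (auto simp: not_le less_eq_Suc_le dest!: spec[of _ x])
    then have "\<exists>c. c ` S \<subseteq> {..<m - 1} \<and>
        (\<forall>u\<in>S. \<forall>v\<in>S. u \<noteq> v \<and> c u = c v \<longrightarrow> I u \<inter> I v = {})"
      using \<open>finite S\<close> ivl assms(7) by (intro interval_colouring) auto
    then obtain c where
      c: "c ` S \<subseteq> {..<m - 1}" "\<And>u v. \<lbrakk>u \<in> S; v \<in> S; u \<noteq> v; c u = c v\<rbrakk> \<Longrightarrow> I u \<inter> I v = {}"
      by auto
    have "(\<Sum>s\<in>S. w i s) = (\<Sum>a<m - 1. \<Sum>s\<in>{s \<in> S. c s = a}. w i s)"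
      using \<open>finite S\<close> c(1) by (simp add: sum.group)
    also have "\<dots> \<le> (\<Sum>a<m - 1. W i)"
    proof (intro sum_mono stable)
      fix a
      show "{s \<in> S. c s = a} \<subseteq> V"
        using assms(7) by blast
      show "indep {s \<in> S. c s = a} (E i)"
        using c(2) edge assms(7) unfolding indep_def by blast
    qed
    also have "\<dots> = of_int (int m - 1) * W i"
      using m(1) by (simp add: of_nat_diff)
    finally have "(\<Sum>s\<in>S. w i s) / W i \<le> of_int (int m - 1)"
      using Wpos by (simp add: pos_divide_le_eq)
    \<comment> \<open>The bound \<open>m - 1\<close> is an integer, so it also bounds the ceiling,
      which is \<open>m\<close>.\<close>
    then have "int m \<le> int m - 1"
      unfolding m(2) by (simp only: ceiling_le_iff)
    then show False
      by simp
  qed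
  \<comment> \<open>More than \<open>m\<close> intervals may contain \<open>x\<close>; any
    \<open>m\<close> of them give a clique of the exact size.\<close>
  then obtain x C where C: "C \<subseteq> {v \<in> S. x \<in> I v}" "card C = m"
    by (metis obtain_subset_with_card_n)
  have "clique C (induced_edges (E i) S)"
    unfolding clique_def
  proof (intro ballI impI)
    fix u v
    assume uv: "u \<in> C" "v \<in> C" "u \<noteq> v"
    then have "u \<in> S" "v \<in> S" "x \<in> I u \<inter> I v"
      using C(1) by auto
    then show "{u, v} \<in> induced_edges (E i) S"
      using edge[of u v] uv(3) assms(7) by (auto simp: induced_edges_def)
  qed
  then show ?thesis
    using C m(2) by auto
qed

end
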